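(* For all integers $r,s\ge 1$, $$D(K_r\,\square\, K_s,x)=\bigl((x+1)^r-1\bigr)^s-\sum_{k=1}^{s-1}\binom{s}{k}(-1)^k\bigl((x+1)^{s-k}-1\bigr)^r .$$
   Context: A set $S\subseteq V(G)$ is dominating in a finite simple graph $G$ if every vertex of $G$ is in $S$ or adjacent to a vertex of $S$. The domination polynomial is $D(G,x)=\sum_{i=0}^{|V(G)|} d_i(G)x^i$, where $d_i(G)$ is the number of dominating sets of $G$ of size $i$. The Cartesian product $G\,\square\, H$ has vertex set $V(G)\times V(H)$, with $(u_1,v_1)$ and $(u_2,v_2)$ adjacent iff either $u_1=u_2$ and $v_1v_2\in E(H)$, or $u_1u_2\in E(G)$ and $v_1=v_2$. $K_r$ is the complete graph on $r$ vertices. *)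

theory Defs
  imports
    "HOL-Computational_Algebra.Polynomial"
    "Graph_Theory.Pair_Digraph"
    "Graph_Theory.Kuratowski"
begin

text \<open>
  A finite simple graph is a \<^locale>\<open>pair_graph\<close>: a finite, loop-free, symmetric set of
  vertex pairs, so the edge $uv$ is the two pairs $(u,v)$ and $(v,u)$.
\<close>

definition dominating_set :: "'a pair_pre_digraph \<Rightarrow> 'a set \<Rightarrow> bool" where
  "dominating_set G S \<longleftrightarrow>
     S \<subseteq> pverts G \<and> (\<forall>v\<in>pverts G. v \<in> S \<or> (\<exists>u\<in>S. (v, u) \<in> parcs G))"

definition dominating_count :: "'a pair_pre_digraph \<Rightarrow> nat \<Rightarrow> nat" where
  "dominating_count G i = card {S. dominating_set G S \<and> card S = i}"

definition domination_poly :: "'a pair_pre_digraph \<Rightarrow> int poly" where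
  "domination_poly G = (\<Sum>i=0..card (pverts G). monom (of_nat (dominating_count G i)) i)"

definition cartesian_product ::
    "'a pair_pre_digraph \<Rightarrow> 'b pair_pre_digraph \<Rightarrow> ('a \<times> 'b) pair_pre_digraph"
    (infixr \<open>\<box>\<close> 70) where
  "G \<box> H =
     \<lparr> pverts = pverts G \<times> pverts H,
       parcs = {((u1, v1), (u2, v2)) | u1 v1 u2 v2.
         (u1 \<in> pverts G \<and> u1 = u2 \<and> (v1, v2) \<in> parcs H) \<or>
         ((u1, u2) \<in> parcs G \<and> v1 \<in> pverts H \<and> v1 = v2)} \<rparr>"

lemma pair_graph_cartesian_product:
  assumes "pair_graph G" and "pair_graph H"
  shows "pair_graph (G \<box> H)"
proof -
  interpret G: pair_graph G by fact
  interpret H: pair_graph H by fact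
  have sub: "parcs (G \<box> H) \<subseteq> pverts (G \<box> H) \<times> pverts (G \<box> H)"
    by (auto simp: cartesian_product_def dest: G.in_arcsD1 G.in_arcsD2 H.in_arcsD1 H.in_arcsD2)
  have fin: "finite (pverts (G \<box> H))"
    using G.pair_finite_verts H.pair_finite_verts by (simp add: cartesian_product_def)
  have "finite (parcs (G \<box> H))"
    using finite_subset[OF sub] fin by simp
  moreover have "sym (parcs (G \<box> H))"
    using G.pair_sym_arcs H.pair_sym_arcs
    by (auto simp: cartesian_product_def symmetric_def sym_def)
  moreover have "fst e \<noteq> snd e" if "e \<in> parcs (G \<box> H)" for e
    using that G.pair_no_loops H.pair_no_loops by (fastforce simp: cartesian_product_def)
  ultimately show ?thesis
    using sub fin by unfold_locales (auto simp: symmetric_def)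
qed

text \<open>
  The library predicate \<^const>\<open>complete_digraph\<close> describes $K_n$ on an arbitrary set of $n$
  vertices; it is satisfiable for every $n$.
\<close>

lemma complete_digraph_lessThan:
  "K\<^bsub>n\<^esub> (with_proj \<lparr> pverts = {..<n}, parcs = {(u, v). u < n \<and> v < n \<and> u \<noteq> v} \<rparr>)"
  by (auto simp: complete_digraph_pair_def)

end

theory Submission
  imports Defs
begin

text \<open>
  Arrange the vertices of \<open>K\<^sub>r \<box> K\<^sub>s\<close> in a grid with \<open>r\<close> rows and \<open>s\<close> columns, so that a vertex is
  adjacent to the rest of its row and the rest of its column. If a set of vertices misses both some
  row and some column, then the vertex where these two cross is not dominated; if it
  meets all rows or all columns, then it dominates everything. So dominating means: meeting every
  row or meeting every column (\<open>dominating_set_grid_iff\<close>).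

  Count sets by the size enumerator \<open>\<Sum>S. x ^ card S\<close>. Sets that meet every column are a free choice
  of a nonempty set in each column, which gives \<open>((x + 1) ^ r - 1) ^ s\<close>
  (\<open>sum_power_card_meeting_cols\<close>). The remaining dominating sets meet every row and miss a column.
  Inclusion-exclusion over the missed columns applies to these: if at least the columns in a set of
  size \<open>k\<close> are missed, then what is left is a set that meets every row of a grid with \<open>s - k\<close>
  columns, which gives \<open>((x + 1) ^ (s - k) - 1) ^ r\<close>
  (\<open>sum_power_card_meeting_rows_missing_col\<close>).
  The term \<open>k = s\<close> vanishes because there is at least one row.
\<close>

section \<open>Size enumerators of sets in a grid\<close>

lemma sum_power_card_Pow:
  fixes x :: "'c::comm_semiring_1"
  assumes "finite A"
  shows "(\<Sum>S\<in>Pow A. x ^ card S) = (x + 1) ^ card A"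
  using prod_add[OF assms, of "\<lambda>_. x" "\<lambda>_. 1"] by simp

text \<open>
  A set that meets every row is the disjoint union \<open>Sigma A f\<close> of its rows, each of them an arbitrary
  nonempty subset of \<open>B\<close>; expanding a product of sums adds up over all such families \<open>f\<close>.
\<close>

lemma sum_power_card_meeting_rows:
  fixes x :: "'c::comm_ring_1"
  assumes "finite A" "finite B"
  shows "(\<Sum>S | S \<subseteq> A \<times> B \<and> fst ` S = A. x ^ card S) = ((x + 1) ^ card B - 1) ^ card A"
proof -
  let ?R = "Pow B - {{}}"
  have "(\<Sum>T\<in>?R. x ^ card T) = (x + 1) ^ card B - 1"
    using assms by (simp add: sum_diff1 sum_power_card_Pow)
  then have "((x + 1) ^ card B - 1) ^ card A = (\<Prod>a\<in>A. \<Sum>T\<in>?R. x ^ card T)"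
    by simp
  also have "\<dots> = (\<Sum>f\<in>PiE A (\<lambda>_. ?R). \<Prod>a\<in>A. x ^ card (f a))"
    using assms by (intro prod_sum_PiE) auto
  also have "\<dots> = (\<Sum>S | S \<subseteq> A \<times> B \<and> fst ` S = A. x ^ card S)"
  proof (rule sum.reindex_bij_witness[where j = "Sigma A" and i = "\<lambda>S. \<lambda>a\<in>A. S `` {a}"])
    fix f assume f: "f \<in> PiE A (\<lambda>_. ?R)"
    show "(\<lambda>a\<in>A. Sigma A f `` {a}) = f"
      using f by (auto simp: fun_eq_iff PiE_def extensional_def)
    have "f a \<noteq> {}" "f a \<subseteq> B" if "a \<in> A" for a
      using PiE_mem[OF f that] by auto
    then show "Sigma A f \<in> {S. S \<subseteq> A \<times> B \<and> fst ` S = A}"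
      by (simp add: fst_image_Sigma subset_iff) blast
    have "card (Sigma A f) = (\<Sum>a\<in>A. card (f a))"
      using f assms by (intro card_SigmaI) (auto dest: PiE_mem intro: finite_subset)
    then show "x ^ card (Sigma A f) = (\<Prod>a\<in>A. x ^ card (f a))"
      by (simp add: power_sum)
  next
    fix S assume "S \<in> {S. S \<subseteq> A \<times> B \<and> fst ` S = A}"
    then show "Sigma A (\<lambda>a\<in>A. S `` {a}) = S" "(\<lambda>a\<in>A. S `` {a}) \<in> PiE A (\<lambda>_. ?R)"
      by (auto split: if_splits)
  qed
  finally show ?thesis ..
qed

lemma sum_power_card_meeting_cols:
  fixes x :: "'c::comm_ring_1"
  assumes "finite A" "finite B"
  shows "(\<Sum>S | S \<subseteq> A \<times> B \<and> snd ` S = B. x ^ card S) = ((x + 1) ^ card A - 1) ^ card B"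
proof -
  have "(\<Sum>S | S \<subseteq> A \<times> B \<and> snd ` S = B. x ^ card S)
      = (\<Sum>S | S \<subseteq> B \<times> A \<and> fst ` S = B. x ^ card S)"
    by (rule sum.reindex_bij_witness[where j = "image prod.swap" and i = "image prod.swap"])
      (auto simp: image_image card_image)
  then show ?thesis
    using assms by (simp add: sum_power_card_meeting_rows)
qed

lemma sum_nonempty_subsets_by_card:
  fixes g :: "nat \<Rightarrow> 'c::semiring_1"
  assumes "finite B"
  shows "(\<Sum>U | U \<subseteq> B \<and> U \<noteq> {}. g (card U)) = (\<Sum>k=1..card B. of_nat (card B choose k) * g k)"
proof -
  let ?\<U> = "{U. U \<subseteq> B \<and> U \<noteq> {}}"
  have "card ` ?\<U> \<subseteq> {1..card B}"
    using assms by (auto simp: card_mono Suc_le_eq card_gt_0_iff dest: finite_subset)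
  then have "(\<Sum>U\<in>?\<U>. g (card U)) = (\<Sum>k=1..card B. \<Sum>U | U \<in> ?\<U> \<and> card U = k. g (card U))"
    using assms by (intro sum.group[symmetric]) auto
  also have "\<dots> = (\<Sum>k=1..card B. of_nat (card B choose k) * g k)"
  proof (rule sum.cong[OF refl])
    fix k assume "k \<in> {1..card B}"
    then have "(\<Sum>U | U \<in> ?\<U> \<and> card U = k. g (card U)) = (\<Sum>U | U \<subseteq> B \<and> card U = k. g k)"
      by (intro sum.cong) auto
    then show "(\<Sum>U | U \<in> ?\<U> \<and> card U = k. g (card U)) = of_nat (card B choose k) * g k"
      by (simp add: n_subsets[OF assms])
  qed
  finally show ?thesis .
qed

text \<open>
  The sets to be enumerated form the union, over \<open>b \<in> B\<close>, of the families \<open>X b\<close> of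
  sets that meet every row and miss column \<open>b\<close>. An intersection of such families over a nonempty
  set of columns consists of the sets that meet every row of the grid without these columns.
\<close>

lemma sum_power_card_meeting_rows_missing_col:
  fixes x :: "'c::comm_ring_1"
  assumes "finite A" "finite B"
  shows "(\<Sum>S | S \<subseteq> A \<times> B \<and> fst ` S = A \<and> snd ` S \<noteq> B. x ^ card S)
    = - (\<Sum>k=1..card B. of_nat (card B choose k) * (- 1) ^ k * ((x + 1) ^ (card B - k) - 1) ^ card A)"
proof -
  define X where "X b = {S. S \<subseteq> A \<times> B \<and> fst ` S = A \<and> b \<notin> snd ` S}" for b
  define w where "w F = (\<Sum>S\<in>F. x ^ card S)" for F :: "('a \<times> 'b) set set"
  interpret Incl_Excl finite w
    by unfold_locales (auto simp: w_def disjnt_def sum.union_disjoint)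
  have fin: "finite (X b)" for b
    by (rule finite_subset[of _ "Pow (A \<times> B)"]) (use assms in \<open>auto simp: X_def\<close>)
  have "S \<subseteq> A \<times> B \<and> fst ` S = A \<and> snd ` S \<noteq> B \<longleftrightarrow> S \<in> \<Union> (X ` B)" for S
  proof (cases "S \<subseteq> A \<times> B")
    case True
    then have "snd ` S \<noteq> B \<longleftrightarrow> (\<exists>b\<in>B. b \<notin> snd ` S)"
      by fastforce
    with True show ?thesis
      by (simp add: X_def)
  qed (simp add: X_def)
  then have union: "{S. S \<subseteq> A \<times> B \<and> fst ` S = A \<and> snd ` S \<noteq> B} = \<Union> (X ` B)"
    by (simp add: set_eq_iff)
  have inter: "w (\<Inter> (X ` U)) = ((x + 1) ^ (card B - card U) - 1) ^ card A"
    if "U \<subseteq> B" "U \<noteq> {}" for U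
  proof -
    have "S \<in> \<Inter> (X ` U) \<longleftrightarrow> S \<subseteq> A \<times> B \<and> fst ` S = A \<and> U \<inter> snd ` S = {}" for S
      using that(2) by (auto simp: X_def disjoint_iff)
    moreover have "S \<subseteq> A \<times> B \<and> U \<inter> snd ` S = {} \<longleftrightarrow> S \<subseteq> A \<times> (B - U)" for S
      by (simp add: subset_iff disjoint_iff image_iff Ball_def split_paired_all) blast
    ultimately have "S \<in> \<Inter> (X ` U) \<longleftrightarrow> S \<subseteq> A \<times> (B - U) \<and> fst ` S = A" for S
      by metis
    then have "\<Inter> (X ` U) = {S. S \<subseteq> A \<times> (B - U) \<and> fst ` S = A}"
      by (simp add: set_eq_iff)
    moreover have "card (B - U) = card B - card U"
      using that assms by (simp add: card_Diff_subset finite_subset)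
    ultimately show ?thesis
      using assms by (simp add: w_def sum_power_card_meeting_rows)
  qed
  have "w (\<Union> (X ` B)) = (\<Sum>U | U \<subseteq> B \<and> U \<noteq> {}. (- 1) ^ (card U + 1) * w (\<Inter> (X ` U)))"
    by (rule restricted_indexed) (use assms fin in auto)
  also have "\<dots> = (\<Sum>U | U \<subseteq> B \<and> U \<noteq> {}.
      - ((- 1) ^ card U * ((x + 1) ^ (card B - card U) - 1) ^ card A))"
    by (rule sum.cong) (auto simp: inter)
  also have "\<dots> = - (\<Sum>k=1..card B. of_nat (card B choose k) *
      ((- 1) ^ k * ((x + 1) ^ (card B - k) - 1) ^ card A))"
    unfolding sum_negf
    using sum_nonempty_subsets_by_card[OF assms(2),
      of "\<lambda>k. (- 1) ^ k * ((x + 1) ^ (card B - k) - 1) ^ card A"] by simp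
  finally show ?thesis
    by (simp add: union w_def mult.assoc)
qed

section \<open>Dominating sets of a product of complete graphs\<close>

lemma domination_poly_eq_sum_power_card:
  assumes "finite (pverts G)"
  shows "domination_poly G = (\<Sum>S | dominating_set G S. [:0, 1:] ^ card S)"
proof -
  let ?D = "{S. dominating_set G S}"
  have sub: "?D \<subseteq> Pow (pverts G)"
    by (auto simp: dominating_set_def)
  then have fin: "finite ?D"
    using assms by (simp add: finite_subset)
  have "(\<Sum>S\<in>?D. [:0, 1:] ^ card S :: int poly)
      = (\<Sum>i=0..card (pverts G). \<Sum>S | S \<in> ?D \<and> card S = i. [:0, 1:] ^ card S)"
    using sub assms fin by (intro sum.group[symmetric]) (auto intro!: card_mono)
  also have "\<dots> = domination_poly G"
    unfolding domination_poly_def dominating_count_def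
    by (intro sum.cong) (simp_all add: monom_altdef of_nat_poly)
  finally show ?thesis ..
qed

lemma dominating_set_grid_iff:
  assumes G: "parcs G = {(u, v). (u, v) \<in> pverts G \<times> pverts G \<and> u \<noteq> v}"
    and H: "parcs H = {(u, v). (u, v) \<in> pverts H \<times> pverts H \<and> u \<noteq> v}"
  shows "dominating_set (G \<box> H) S \<longleftrightarrow>
    S \<subseteq> pverts G \<times> pverts H \<and> (fst ` S = pverts G \<or> snd ` S = pverts H)"
proof (cases "S \<subseteq> pverts G \<times> pverts H")
  case True
  have arc: "(p, q) \<in> parcs (G \<box> H) \<longleftrightarrow> p \<noteq> q \<and> (fst p = fst q \<or> snd p = snd q)"
    if "p \<in> pverts G \<times> pverts H" "q \<in> pverts G \<times> pverts H" for p q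
    using that by (cases p; cases q) (auto simp: cartesian_product_def G H)
  have "p \<in> S \<or> (\<exists>q\<in>S. (p, q) \<in> parcs (G \<box> H)) \<longleftrightarrow> fst p \<in> fst ` S \<or> snd p \<in> snd ` S"
    if p: "p \<in> pverts G \<times> pverts H" for p
  proof -
    have "(\<exists>q\<in>S. (p, q) \<in> parcs (G \<box> H)) \<longleftrightarrow> (\<exists>q\<in>S. p \<noteq> q \<and> (fst p = fst q \<or> snd p = snd q))"
      using arc[OF p] True by blast
    then show ?thesis
      unfolding image_iff by metis
  qed
  then have "dominating_set (G \<box> H) S \<longleftrightarrow>
      (\<forall>a\<in>pverts G. \<forall>b\<in>pverts H. a \<in> fst ` S \<or> b \<in> snd ` S)"
    using True by (simp add: dominating_set_def cartesian_product_def)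
  also have "\<dots> \<longleftrightarrow> pverts G \<subseteq> fst ` S \<or> pverts H \<subseteq> snd ` S"
    by blast
  also have "\<dots> \<longleftrightarrow> fst ` S = pverts G \<or> snd ` S = pverts H"
    using True by auto
  finally show ?thesis
    using True by simp
qed (simp add: dominating_set_def cartesian_product_def)

theorem theorem3p2:
  fixes G :: "'a pair_pre_digraph" and H :: "'b pair_pre_digraph" and r s :: nat
  assumes "r \<ge> 1" and "s \<ge> 1"
    and "K\<^bsub>r\<^esub> (with_proj G)" and "K\<^bsub>s\<^esub> (with_proj H)"
  shows "domination_poly (G \<box> H) =
    ([:1, 1:] ^ r - 1) ^ s
      - (\<Sum>k=1..s - 1. of_nat (s choose k) * (- 1) ^ k * ([:1, 1:] ^ (s - k) - 1) ^ r)"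
proof -
  define A where "A = pverts G"
  define B where "B = pverts H"
  define X :: "int poly" where "X = [:0, 1:]"
  have A: "finite A" "card A = r" "parcs G = {(u, v). (u, v) \<in> pverts G \<times> pverts G \<and> u \<noteq> v}"
    using assms(3) unfolding complete_digraph_pair_def A_def by blast+
  have B: "finite B" "card B = s" "parcs H = {(u, v). (u, v) \<in> pverts H \<times> pverts H \<and> u \<noteq> v}"
    using assms(4) unfolding complete_digraph_pair_def B_def by blast+
  let ?cols = "{S. S \<subseteq> A \<times> B \<and> snd ` S = B}"
  let ?rows = "{S. S \<subseteq> A \<times> B \<and> fst ` S = A \<and> snd ` S \<noteq> B}"
  let ?t = "\<lambda>k. of_nat (s choose k) * (- 1) ^ k * ((X + 1) ^ (s - k) - 1) ^ r"
  have fin: "finite ?cols" "finite ?rows"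
    using A B by simp_all
  have split: "{S. dominating_set (G \<box> H) S} = ?cols \<union> ?rows"
    unfolding dominating_set_grid_iff[OF A(3) B(3)] A_def B_def by blast
  have "finite (pverts (G \<box> H))"
    using A B by (simp add: cartesian_product_def A_def B_def)
  then have "domination_poly (G \<box> H) = (\<Sum>S\<in>?cols \<union> ?rows. X ^ card S)"
    by (simp add: domination_poly_eq_sum_power_card split X_def)
  also have "\<dots> = (\<Sum>S\<in>?cols. X ^ card S) + (\<Sum>S\<in>?rows. X ^ card S)"
    using fin by (intro sum.union_disjoint) auto
  also have "\<dots> = ((X + 1) ^ r - 1) ^ s - (\<Sum>k=1..s. ?t k)"
    using A B by (simp add: sum_power_card_meeting_cols sum_power_card_meeting_rows_missing_col)
  also have "(\<Sum>k=1..s. ?t k) = (\<Sum>k=1..s - 1. ?t k)"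
  proof -
    have "(\<Sum>k=1..s. ?t k) = (\<Sum>k=1..s - 1. ?t k) + ?t s"
      using assms(2) by (cases s) simp_all
    moreover have "?t s = 0"
      using assms(1) by (simp add: power_0_left)
    ultimately show ?thesis
      by simp
  qed
  also have "X + 1 = [:1, 1:]"
    by (simp add: X_def one_pCons)
  finally show ?thesis .
qed

end
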